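(* Let $f:\mathbb{R}^n\to\mathbb{R}$ be continuously differentiable, let $\eta>0$, and let $\boldsymbol\theta\in\mathbb{R}^n$ satisfy $\nabla f(\boldsymbol\theta)\neq 0$. Then $$\mathsf{RP}(\boldsymbol\theta)=-1+\frac{\eta}{2}\cdot 2\int_0^1 \tau\cdot L\bigl(\boldsymbol\theta;\eta\tau\nabla f(\boldsymbol\theta)\bigr)\,\mathrm{d}\tau .$$
   Context: The relative progress ratio (for step size $\eta$) is $$\mathsf{RP}(\boldsymbol\theta):=\frac{f(\boldsymbol\theta-\eta\nabla f(\boldsymbol\theta))-f(\boldsymbol\theta)}{\eta\|\nabla f(\boldsymbol\theta)\|^2}.$$ For a nonzero update vector $\mathbf{v}$, the directional smoothness is $$L(\boldsymbol\theta;\mathbf{v}):=\frac{1}{\|\mathbf{v}\|^2}\bigl\langle \mathbf{v},\,\nabla f(\boldsymbol\theta)-\nabla f(\boldsymbol\theta-\mathbf{v})\bigr\rangle .$$ Here $\langle\cdot,\cdot\rangle$ and $\|\cdot\|$ are the Euclidean inner product and norm. The integrand is defined for $\tau\in(0,1]$; its value at the single point $\tau=0$ is irrelevant to the integral. *)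

theory Defs
  imports "HOL-Analysis.Analysis"
begin

text \<open>The description is proper at every point of differentiability, since \<^term>\<open>GDERIV f x :> D\<close>
  determines \<^term>\<open>D\<close> there; elsewhere the value is unspecified.\<close>

definition gradient :: "(real ^ 'n \<Rightarrow> real) \<Rightarrow> real ^ 'n \<Rightarrow> real ^ 'n" where
  "gradient f x = (THE D. GDERIV f x :> D)"

definition continuously_differentiable :: "(real ^ 'n \<Rightarrow> real) \<Rightarrow> bool" where
  "continuously_differentiable f \<longleftrightarrow>
     (\<forall>x. f differentiable (at x)) \<and> continuous_on UNIV (gradient f)"

definition relative_progress :: "(real ^ 'n \<Rightarrow> real) \<Rightarrow> real \<Rightarrow> real ^ 'n \<Rightarrow> real" where
  "relative_progress f \<eta> \<theta> =
     (f (\<theta> - \<eta> *\<^sub>R gradient f \<theta>) - f \<theta>) / (\<eta> * (norm (gradient f \<theta>))\<^sup>2)"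

text \<open>Meaningful for nonzero \<^term>\<open>v\<close>; at \<^term>\<open>v = 0\<close> it is 0 by the convention for division by 0.\<close>

definition directional_smoothness ::
    "(real ^ 'n \<Rightarrow> real) \<Rightarrow> real ^ 'n \<Rightarrow> real ^ 'n \<Rightarrow> real" where
  "directional_smoothness f \<theta> v =
     1 / (norm v)\<^sup>2 * (v \<bullet> (gradient f \<theta> - gradient f (\<theta> - v)))"

end

theory Submission
  imports Defs
begin

text \<open>Write g for the gradient at \<theta>. In \<tau> * L(\<theta>; \<eta>\<tau>g) the powers
  of \<tau> cancel, leaving 1/\<eta> - <g, grad f(\<theta> - \<eta>\<tau>g)> / (\<eta>|g|^2). By the
  chain rule the inner product is -1/\<eta> times the derivative of f along the segment from
  \<theta> to \<theta> - \<eta>g. Integrating over [0,1] therefore gives 1/\<eta> plus the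
  normalised change of f, that is (1 + RP)/\<eta>; solving for RP gives the claim.
  \<open>GDERIV_gradient\<close> supplies the chain rule's input, and
  \<open>has_integral_directional_smoothness\<close> does the integration.\<close>

lemma GDERIV_gradient:
  fixes f :: "real ^ 'n \<Rightarrow> real"
  assumes "f differentiable (at x)"
  shows "GDERIV f x :> gradient f x"
proof -
  obtain f' where f': "(f has_derivative f') (at x)"
    using assms by (auto simp: differentiable_def)
  \<comment> \<open>The Riesz vector of the linear functional \<open>f'\<close>, read off from its
    values on the standard basis.\<close>
  define D where "D = (\<Sum>b\<in>Basis. f' b *\<^sub>R b)"
  have "f' h = h \<bullet> D" for h
  proof -
    have "f' h = (\<Sum>b\<in>Basis. f' ((h \<bullet> b) *\<^sub>R b))"
      using linear_sum[OF has_derivative_linear[OF f']] by (metis euclidean_representation)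
    also have "\<dots> = h \<bullet> D"
      by (simp add: D_def inner_sum_right linear_cmul[OF has_derivative_linear[OF f']] mult.commute)
    finally show ?thesis .
  qed
  then have D: "GDERIV f x :> D"
    using f' unfolding gderiv_def by (metis (no_types) ext)
  have "E = D" if "GDERIV f x :> E" for E
    using has_derivative_unique[OF D[unfolded gderiv_def] that[unfolded gderiv_def]]
    by (metis vector_eq_rdot inner_commute)
  with D show ?thesis
    unfolding gradient_def by (rule theI)
qed

text \<open>Stated with \<open>has_integral\<close>, so that integrability and the value of the
  integral both follow from one explicit antiderivative.\<close>

lemma has_integral_directional_smoothness:
  fixes f :: "real ^ 'n \<Rightarrow> real"
  assumes diff: "\<And>x. f differentiable (at x)"
    and "\<eta> > 0" and "gradient f \<theta> \<noteq> 0"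
  shows "((\<lambda>\<tau>. \<tau> * directional_smoothness f \<theta> ((\<eta> * \<tau>) *\<^sub>R gradient f \<theta>)) has_integral
    (1 + relative_progress f \<eta> \<theta>) / \<eta>) {0..1}"
proof -
  define g where "g = gradient f \<theta>"
  define c where "c = 1 / (\<eta>\<^sup>2 * (norm g)\<^sup>2)"
  \<comment> \<open>The antiderivative: \<open>c\<close> is chosen so that differentiating f along
    the segment, which brings out a factor -\<eta>, reproduces the second term of the
    integrand.\<close>
  define F where "F = (\<lambda>t. t * (1 / \<eta>) + c * f (\<theta> - (\<eta> * t) *\<^sub>R g))"
  have g: "g \<noteq> 0"
    using assms by (simp add: g_def)
  \<comment> \<open>The closed form also holds at \<tau> = 0: the left side is 0 because of the
    factor \<tau>, and the right side is 1/\<eta> - 1/\<eta> because the gradient there is g itself.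
    So no endpoint has to be excluded below.\<close>
  have integrand: "\<tau> * directional_smoothness f \<theta> ((\<eta> * \<tau>) *\<^sub>R g) =
      1 / \<eta> - \<eta> * (g \<bullet> gradient f (\<theta> - (\<eta> * \<tau>) *\<^sub>R g)) / (\<eta>\<^sup>2 * (norm g)\<^sup>2)" for \<tau>
  proof (cases "\<tau> = 0")
    case True
    then show ?thesis
      using g \<open>\<eta> > 0\<close>
      by (simp add: power2_norm_eq_inner power2_eq_square[of \<eta>] flip: g_def)
  next
    case False
    then show ?thesis
      using g \<open>\<eta> > 0\<close> unfolding directional_smoothness_def g_def[symmetric]
      by (simp add: inner_diff_right power_mult_distrib field_simps power2_eq_square
          flip: power2_norm_eq_inner)
  qed
  have "(F has_vector_derivative \<tau> * directional_smoothness f \<theta> ((\<eta> * \<tau>) *\<^sub>R g))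
      (at \<tau> within {0..1})" for \<tau>
  proof -
    have "(f has_derivative (\<lambda>h. h \<bullet> gradient f (\<theta> - (\<eta> * \<tau>) *\<^sub>R g)))
        (at (\<theta> - (\<eta> * \<tau>) *\<^sub>R g))"
      using GDERIV_gradient[OF diff] by (simp add: gderiv_def)
    then have "((\<lambda>t. f (\<theta> - (\<eta> * t) *\<^sub>R g)) has_derivative
        (\<lambda>h. - ((\<eta> * h) *\<^sub>R g) \<bullet> gradient f (\<theta> - (\<eta> * \<tau>) *\<^sub>R g))) (at \<tau> within {0..1})"
      by (rule has_derivative_compose[rotated]) (auto intro!: derivative_eq_intros)
    then have "(F has_derivative (\<lambda>h. h * (1 / \<eta>) +
        c * (- ((\<eta> * h) *\<^sub>R g) \<bullet> gradient f (\<theta> - (\<eta> * \<tau>) *\<^sub>R g)))) (at \<tau> within {0..1})"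
      unfolding F_def
      by (intro has_derivative_add has_derivative_mult_right has_derivative_mult_left
          has_derivative_ident)
    then show ?thesis
      by (simp add: has_vector_derivative_def integrand c_def algebra_simps)
  qed
  then have "((\<lambda>\<tau>. \<tau> * directional_smoothness f \<theta> ((\<eta> * \<tau>) *\<^sub>R g)) has_integral (F 1 - F 0)) {0..1}"
    by (intro fundamental_theorem_of_calculus) auto
  \<comment> \<open>The linear term contributes 1/\<eta>, and \<open>c\<close> times the change of f
    is RP/\<eta>.\<close>
  moreover have "F 1 - F 0 = (1 + relative_progress f \<eta> \<theta>) / \<eta>"
    using g \<open>\<eta> > 0\<close> unfolding F_def c_def relative_progress_def g_def[symmetric]
    by (simp add: field_simps power2_eq_square)
  ultimately show ?thesis
    by (simp add: g_def)
qed

theorem theorem2: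
  fixes f :: "real ^ 'n \<Rightarrow> real" and \<eta> :: real and \<theta> :: "real ^ 'n"
  assumes "continuously_differentiable f"
    and "\<eta> > 0"
    and "gradient f \<theta> \<noteq> 0"
  shows "(\<lambda>\<tau>. \<tau> * directional_smoothness f \<theta> ((\<eta> * \<tau>) *\<^sub>R gradient f \<theta>)) integrable_on {0..1}
    \<and> relative_progress f \<eta> \<theta> =
        - 1 + \<eta> / 2 * (2 * integral {0..1}
          (\<lambda>\<tau>. \<tau> * directional_smoothness f \<theta> ((\<eta> * \<tau>) *\<^sub>R gradient f \<theta>)))"
proof -
  have "f differentiable (at x)" for x
    using assms(1) by (simp add: continuously_differentiable_def)
  then have I: "((\<lambda>\<tau>. \<tau> * directional_smoothness f \<theta> ((\<eta> * \<tau>) *\<^sub>R gradient f \<theta>)) has_integral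
      (1 + relative_progress f \<eta> \<theta>) / \<eta>) {0..1}"
    using assms(2,3) by (rule has_integral_directional_smoothness)
  show ?thesis
    using has_integral_integrable[OF I] integral_unique[OF I] \<open>\<eta> > 0\<close>
    by (simp add: field_simps)
qed

end
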